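(* Let $\mathcal B$ be a bicategory. A horizontal arrow $$A_0\xrightarrow{f_1}\cdots\xrightarrow{f_{i_0}}[A_{i_0}]\xrightarrow{f_{i_0+1}}\cdots\xrightarrow{f_{i_1}}[A_{i_1}]\xrightarrow{f_{i_1+1}}\cdots\xrightarrow{f_n}A_n$$ in the double category $\mathbf{Dbl}(\mathcal B)$ of marked paths has a companion if and only if $A_{i_0}=A_{i_1}$ and the chosen composition $\varphi_{f_{i_0+1}\cdots f_{i_1}}$ is a quasi unit in $\mathcal B$.
   Context: **Double category notation.** In a double category, $\mathrm{Id}_A$ is the horizontal identity arrow and $1_A$ the vertical identity arrow on $A$, $1_f$ is the vertical identity cell on a horizontal arrow $f$, $\mathrm{id}_v$ the horizontal identity cell on a vertical arrow $v$, $\circ$ is horizontal and $\cdot$ vertical composition. A horizontal arrow $f:A\to B$ and a vertical arrow $v$ from $A$ to $B$ are companions if there are double cells $\psi$ (top $\mathrm{Id}_A$, left $1_A$, right $v$, bottom $f$) and $\chi$ (top $f$, left $v$, right $1_B$, bottom $\mathrm{Id}_B$) with $\chi\circ\psi=1_f$ and $\chi\cdot\psi=\mathrm{id}_v$. A quasi unit in a bicategory is an endomorphism $f:A\to A$ admitting an invertible 2-cell $f\cong1_A$. **The double category $\mathbf{Dbl}(\mathcal B)$ of marked paths.** Choose for each finite path $A_0\xrightarrow{f_1}A_1\to\cdots\xrightarrow{f_n}A_n$ of composable arrows in $\mathcal B$ a composite $\varphi_{f_1\cdots f_n}$ (also written $\varphi_{f_1,\dots,f_n}$; a bracketing of the path,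 with $\varphi_{A_0}=1_{A_0}$ for the empty path at $A_0$ and $\varphi_f=f$). For a concatenation of paths, the associativity and unit cells give unique invertible comparison 2-cells $\Phi$ between the composite of the chosen composites and the chosen composite of the concatenation. - Objects: pairs $(A_0\xrightarrow{f_1}\cdots\xrightarrow{f_n}A_n;\,i_0)$ of a finite path in $\mathcal B$ ($n\ge0$) and $0\le i_0\le n$ (a marked object $[A_{i_0}]$). - Vertical arrows: there is a unique vertical arrow from $(A_0\to\cdots\to A_n;i_0)$ to $(B_0\to\cdots\to B_m;j_0)$ if $A_{i_0}=B_{j_0}$, and none otherwise. - Horizontal arrows: $(A_0\xrightarrow{f_1}\cdots\xrightarrow{f_n}A_n;\,i_0,i_1)$ with $i_0\le i_1$, with domain the same path marked at $i_0$ and codomain the same path marked at $i_1$; two are composable iff the paths agree and the marks match, with composite $(\ldots;i_0,i_1)$ followed by $(\ldots;i_1,i_2)$ equal to $(\ldots;i_0,i_2)$. - Double cells with top $(A_0\xrightarrow{f_1}\cdots A_n;i_0,i_1)$ and bottom $(B_0\xrightarrow{g_1}\cdots B_m;j_0,j_1)$ exist only when $A_{i_0}=B_{j_0}$, $A_{i_1}=B_{j_1}$, and are then 2-cells $\alpha:\varphi_{f_{i_0+1}\cdots f_{i_1}}\Rightarrow\varphi_{g_{j_0+1}\cdots g_{j_1}}$ in $\mathcal B$. Vertical composition is vertical composition of 2-cells; the horizontal composite of $\alpha$ and $\beta$ is the horizontal composite of the 2-cells in $\mathcal B$ conjugated by the comparison 2-cells $\Phi$. *)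

theory Defs
  imports Main
begin

section \<open>Bicategories\<close>

text \<open>
  All compositions are written in applicative order: \<open>g \<odot> f\<close> is \<open>f\<close> followed by \<open>g\<close>,
  and likewise for the vertical composite \<open>b \<cdot> a\<close> and the horizontal composite \<open>b \<star> a\<close>
  of 2-cells. The operations are only meaningful on the carriers.
\<close>

record ('o, 'a, 'c) bicat =
  Obj  :: "'o set"
  Arr  :: "'a set"
  Cell :: "'c set"
  Dom  :: "'a \<Rightarrow> 'o"
  Cod  :: "'a \<Rightarrow> 'o"
  Src  :: "'c \<Rightarrow> 'a"
  Tgt  :: "'c \<Rightarrow> 'a"
  unit1 :: "'o \<Rightarrow> 'a"
  comp1 :: "'a \<Rightarrow> 'a \<Rightarrow> 'a"  (infixl \<open>\<odot>\<index>\<close> 75)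
  ident :: "'a \<Rightarrow> 'c"
  vcomp :: "'c \<Rightarrow> 'c \<Rightarrow> 'c"  (infixl \<open>\<cdot>\<index>\<close> 65)
  hcomp :: "'c \<Rightarrow> 'c \<Rightarrow> 'c"  (infixl \<open>\<star>\<index>\<close> 70)
  assoc :: "'a \<Rightarrow> 'a \<Rightarrow> 'a \<Rightarrow> 'c"
  lunit :: "'a \<Rightarrow> 'c"
  runit :: "'a \<Rightarrow> 'c"

definition cells :: "('o, 'a, 'c) bicat \<Rightarrow> 'a \<Rightarrow> 'a \<Rightarrow> 'c set" where
  "cells B f g = {a \<in> Cell B. Src B a = f \<and> Tgt B a = g}"

definition inverse_cells :: "('o, 'a, 'c) bicat \<Rightarrow> 'c \<Rightarrow> 'c \<Rightarrow> bool" where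
  "inverse_cells B a b \<longleftrightarrow>
     a \<in> Cell B \<and> b \<in> cells B (Tgt B a) (Src B a) \<and>
     vcomp B b a = ident B (Src B a) \<and> vcomp B a b = ident B (Tgt B a)"

definition invertible_cell :: "('o, 'a, 'c) bicat \<Rightarrow> 'c \<Rightarrow> bool" where
  "invertible_cell B a \<longleftrightarrow> (\<exists>b. inverse_cells B a b)"

locale bicategory =
  fixes B :: "('o, 'a, 'c) bicat" (structure)
  assumes Dom_Obj: "f \<in> Arr B \<Longrightarrow> Dom B f \<in> Obj B"
    and Cod_Obj: "f \<in> Arr B \<Longrightarrow> Cod B f \<in> Obj B"
    and Src_Arr: "a \<in> Cell B \<Longrightarrow> Src B a \<in> Arr B"
    and Tgt_Arr: "a \<in> Cell B \<Longrightarrow> Tgt B a \<in> Arr B"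
    and Cell_Dom: "a \<in> Cell B \<Longrightarrow> Dom B (Src B a) = Dom B (Tgt B a)"
    and Cell_Cod: "a \<in> Cell B \<Longrightarrow> Cod B (Src B a) = Cod B (Tgt B a)"
    and unit1: "A \<in> Obj B \<Longrightarrow>
      unit1 B A \<in> Arr B \<and> Dom B (unit1 B A) = A \<and> Cod B (unit1 B A) = A"
    and comp1: "\<lbrakk>f \<in> Arr B; g \<in> Arr B; Cod B f = Dom B g\<rbrakk> \<Longrightarrow>
      g \<odot> f \<in> Arr B \<and> Dom B (g \<odot> f) = Dom B f \<and> Cod B (g \<odot> f) = Cod B g"
    and ident: "f \<in> Arr B \<Longrightarrow> ident B f \<in> cells B f f"
    and vcomp: "\<lbrakk>a \<in> cells B f g; b \<in> cells B g h\<rbrakk> \<Longrightarrow> b \<cdot> a \<in> cells B f h"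
    and vcomp_ident_right: "a \<in> cells B f g \<Longrightarrow> a \<cdot> ident B f = a"
    and vcomp_ident_left: "a \<in> cells B f g \<Longrightarrow> ident B g \<cdot> a = a"
    and vcomp_assoc: "\<lbrakk>a \<in> cells B f g; b \<in> cells B g h; c \<in> cells B h k\<rbrakk> \<Longrightarrow>
      (c \<cdot> b) \<cdot> a = c \<cdot> (b \<cdot> a)"
    and hcomp: "\<lbrakk>a \<in> cells B f f'; b \<in> cells B g g'; Cod B f = Dom B g\<rbrakk> \<Longrightarrow>
      b \<star> a \<in> cells B (g \<odot> f) (g' \<odot> f')"
    and hcomp_ident: "\<lbrakk>f \<in> Arr B; g \<in> Arr B; Cod B f = Dom B g\<rbrakk> \<Longrightarrow>
      ident B g \<star> ident B f = ident B (g \<odot> f)"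
    and interchange: "\<lbrakk>a \<in> cells B f f'; a' \<in> cells B f' f'';
      b \<in> cells B g g'; b' \<in> cells B g' g''; Cod B f = Dom B g\<rbrakk> \<Longrightarrow>
      (b' \<cdot> b) \<star> (a' \<cdot> a) = (b' \<star> a') \<cdot> (b \<star> a)"
    and assoc: "\<lbrakk>f \<in> Arr B; g \<in> Arr B; h \<in> Arr B; Cod B f = Dom B g; Cod B g = Dom B h\<rbrakk> \<Longrightarrow>
      assoc B h g f \<in> cells B ((h \<odot> g) \<odot> f) (h \<odot> (g \<odot> f)) \<and> invertible_cell B (assoc B h g f)"
    and assoc_natural: "\<lbrakk>a \<in> cells B f f'; b \<in> cells B g g'; c \<in> cells B h h';
      Cod B f = Dom B g; Cod B g = Dom B h\<rbrakk> \<Longrightarrow>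
      assoc B h' g' f' \<cdot> ((c \<star> b) \<star> a) = (c \<star> (b \<star> a)) \<cdot> assoc B h g f"
    and lunit: "f \<in> Arr B \<Longrightarrow>
      lunit B f \<in> cells B (unit1 B (Cod B f) \<odot> f) f \<and> invertible_cell B (lunit B f)"
    and lunit_natural: "a \<in> cells B f g \<Longrightarrow>
      lunit B g \<cdot> (ident B (unit1 B (Cod B f)) \<star> a) = a \<cdot> lunit B f"
    and runit: "f \<in> Arr B \<Longrightarrow>
      runit B f \<in> cells B (f \<odot> unit1 B (Dom B f)) f \<and> invertible_cell B (runit B f)"
    and runit_natural: "a \<in> cells B f g \<Longrightarrow>
      runit B g \<cdot> (a \<star> ident B (unit1 B (Dom B f))) = a \<cdot> runit B f"
    and pentagon: "\<lbrakk>f \<in> Arr B; g \<in> Arr B; h \<in> Arr B; k \<in> Arr B;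
      Cod B f = Dom B g; Cod B g = Dom B h; Cod B h = Dom B k\<rbrakk> \<Longrightarrow>
      assoc B k h (g \<odot> f) \<cdot> assoc B (k \<odot> h) g f =
      (ident B k \<star> assoc B h g f) \<cdot> (assoc B k (h \<odot> g) f \<cdot> (assoc B k h g \<star> ident B f))"
    and triangle: "\<lbrakk>f \<in> Arr B; g \<in> Arr B; Cod B f = Dom B g\<rbrakk> \<Longrightarrow>
      (ident B g \<star> lunit B f) \<cdot> assoc B g (unit1 B (Cod B f)) f = runit B g \<star> ident B f"

definition quasi_unit :: "('o, 'a, 'c) bicat \<Rightarrow> 'a \<Rightarrow> bool" where
  "quasi_unit B f \<longleftrightarrow> f \<in> Arr B \<and> Dom B f = Cod B f \<and>
     (\<exists>a \<in> cells B f (unit1 B (Dom B f)). invertible_cell B a)"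


section \<open>Double categories: data and companions\<close>

text \<open>
  Only the data of a (strict) double category are recorded: the notion of companion refers
  to nothing else.
\<close>

record ('o, 'h, 'v, 's) double_cat =
  DObj :: "'o set"
  Hor  :: "'h set"
  Ver  :: "'v set"
  Sq   :: "'s set"
  hdom :: "'h \<Rightarrow> 'o"
  hcod :: "'h \<Rightarrow> 'o"
  vdom :: "'v \<Rightarrow> 'o"
  vcod :: "'v \<Rightarrow> 'o"
  top_of    :: "'s \<Rightarrow> 'h"
  bottom_of :: "'s \<Rightarrow> 'h"
  left_of   :: "'s \<Rightarrow> 'v"
  right_of  :: "'s \<Rightarrow> 'v"
  hor_id   :: "'o \<Rightarrow> 'h"
  ver_id   :: "'o \<Rightarrow> 'v"
  hor_comp :: "'h \<Rightarrow> 'h \<Rightarrow> 'h"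
  ver_comp :: "'v \<Rightarrow> 'v \<Rightarrow> 'v"
  sq_ver_id   :: "'h \<Rightarrow> 's"
  sq_hor_id   :: "'v \<Rightarrow> 's"
  sq_hor_comp :: "'s \<Rightarrow> 's \<Rightarrow> 's"
  sq_ver_comp :: "'s \<Rightarrow> 's \<Rightarrow> 's"

definition is_square ::
    "('o, 'h, 'v, 's) double_cat \<Rightarrow> 's \<Rightarrow> 'h \<Rightarrow> 'v \<Rightarrow> 'v \<Rightarrow> 'h \<Rightarrow> bool" where
  "is_square D s t l r b \<longleftrightarrow>
     s \<in> Sq D \<and> top_of D s = t \<and> left_of D s = l \<and> right_of D s = r \<and> bottom_of D s = b"

definition companions :: "('o, 'h, 'v, 's) double_cat \<Rightarrow> 'h \<Rightarrow> 'v \<Rightarrow> bool" where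
  "companions D f v \<longleftrightarrow>
     f \<in> Hor D \<and> v \<in> Ver D \<and> vdom D v = hdom D f \<and> vcod D v = hcod D f \<and>
     (\<exists>\<psi> \<chi>.
        is_square D \<psi> (hor_id D (hdom D f)) (ver_id D (hdom D f)) v f \<and>
        is_square D \<chi> f v (ver_id D (hcod D f)) (hor_id D (hcod D f)) \<and>
        sq_hor_comp D \<chi> \<psi> = sq_ver_id D f \<and>
        sq_ver_comp D \<chi> \<psi> = sq_hor_id D v)"

definition has_companion :: "('o, 'h, 'v, 's) double_cat \<Rightarrow> 'h \<Rightarrow> bool" where
  "has_companion D f \<longleftrightarrow> (\<exists>v. companions D f v)"


section \<open>Paths, bracketings and comparison cells\<close>

text \<open>
  The path from \<open>A\<^sub>0\<close> along \<open>f\<^sub>1, \<dots>, f\<^sub>n\<close> is the pair of \<open>A\<^sub>0\<close> and the list of the \<open>f\<^sub>i\<close>; the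
  starting object is needed for empty paths.
\<close>

type_synonym ('o, 'a) path = "'o \<times> 'a list"

fun is_path :: "('o, 'a, 'c) bicat \<Rightarrow> ('o, 'a) path \<Rightarrow> bool" where
  "is_path B (A, []) \<longleftrightarrow> A \<in> Obj B"
| "is_path B (A, f # fs) \<longleftrightarrow> f \<in> Arr B \<and> Dom B f = A \<and> is_path B (Cod B f, fs)"

abbreviation path_length :: "('o, 'a) path \<Rightarrow> nat" where
  "path_length P \<equiv> length (snd P)"

definition vertex :: "('o, 'a, 'c) bicat \<Rightarrow> ('o, 'a) path \<Rightarrow> nat \<Rightarrow> 'o" where
  "vertex B P i = (if i = 0 then fst P else Cod B (snd P ! (i - 1)))"

text \<open>The subpath along \<open>f\<^sub>i\<^sub>+\<^sub>1, \<dots>, f\<^sub>j\<close>; for \<open>i = j\<close> it is the empty path at \<open>A\<^sub>i\<close>.\<close>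

definition segment :: "('o, 'a, 'c) bicat \<Rightarrow> ('o, 'a) path \<Rightarrow> nat \<Rightarrow> nat \<Rightarrow> ('o, 'a) path" where
  "segment B P i j = (vertex B P i, drop i (take j (snd P)))"

text \<open>
  Formal composites. \<open>Comp u t\<close> is \<open>t\<close> followed by \<open>u\<close>, so that the arrows of \<open>t\<close> come first
  in the underlying path. Units are needed because a chosen composite of an empty path can be
  one of the factors being composed.
\<close>

datatype ('o, 'a) bracketing =
    Unit 'o
  | Arrow 'a
  | Comp "('o, 'a) bracketing" "('o, 'a) bracketing"

fun eval :: "('o, 'a, 'c) bicat \<Rightarrow> ('o, 'a) bracketing \<Rightarrow> 'a" where
  "eval B (Unit A) = unit1 B A"
| "eval B (Arrow f) = f"
| "eval B (Comp u t) = comp1 B (eval B u) (eval B t)"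

fun well_formed :: "('o, 'a, 'c) bicat \<Rightarrow> ('o, 'a) bracketing \<Rightarrow> bool" where
  "well_formed B (Unit A) \<longleftrightarrow> A \<in> Obj B"
| "well_formed B (Arrow f) \<longleftrightarrow> f \<in> Arr B"
| "well_formed B (Comp u t) \<longleftrightarrow>
     well_formed B u \<and> well_formed B t \<and> Cod B (eval B t) = Dom B (eval B u)"

fun arrows :: "('o, 'a) bracketing \<Rightarrow> 'a list" where
  "arrows (Unit A) = []"
| "arrows (Arrow f) = [f]"
| "arrows (Comp u t) = arrows t @ arrows u"

fun unit_free :: "('o, 'a) bracketing \<Rightarrow> bool" where
  "unit_free (Unit A) \<longleftrightarrow> False"
| "unit_free (Arrow f) \<longleftrightarrow> True"
| "unit_free (Comp u t) \<longleftrightarrow> unit_free u \<and> unit_free t"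

definition choice_of_composites ::
    "('o, 'a, 'c) bicat \<Rightarrow> (('o, 'a) path \<Rightarrow> ('o, 'a) bracketing) \<Rightarrow> bool" where
  "choice_of_composites B \<phi> \<longleftrightarrow>
     (\<forall>A \<in> Obj B. \<phi> (A, []) = Unit A) \<and>
     (\<forall>f \<in> Arr B. \<phi> (Dom B f, [f]) = Arrow f) \<and>
     (\<forall>A fs. is_path B (A, fs) \<longrightarrow> fs \<noteq> [] \<longrightarrow>
        unit_free (\<phi> (A, fs)) \<and> arrows (\<phi> (A, fs)) = fs)"

text \<open>
  \<open>structural B t u a\<close> states that the 2-cell \<open>a\<close>, from the value of \<open>t\<close> to that of \<open>u\<close>, is
  built from associativity and unit cells. It is indexed by formal composites, not by arrows of
  \<open>B\<close>: coherence makes \<open>a\<close> unique for given \<open>t\<close> and \<open>u\<close>, whereas different formal composites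
  may accidentally have the same value.
\<close>

inductive structural ::
    "('o, 'a, 'c) bicat \<Rightarrow> ('o, 'a) bracketing \<Rightarrow> ('o, 'a) bracketing \<Rightarrow> 'c \<Rightarrow> bool"
  for B :: "('o, 'a, 'c) bicat" where
  str_ident: "well_formed B t \<Longrightarrow> structural B t t (ident B (eval B t))"
| str_assoc: "well_formed B (Comp (Comp v u) t) \<Longrightarrow>
    structural B (Comp (Comp v u) t) (Comp v (Comp u t))
      (assoc B (eval B v) (eval B u) (eval B t))"
| str_lunit: "well_formed B t \<Longrightarrow>
    structural B (Comp (Unit (Cod B (eval B t))) t) t (lunit B (eval B t))"
| str_runit: "well_formed B t \<Longrightarrow>
    structural B (Comp t (Unit (Dom B (eval B t)))) t (runit B (eval B t))"
| str_inverse: "structural B t u a \<Longrightarrow> inverse_cells B a b \<Longrightarrow> structural B u t b"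
| str_vcomp: "structural B t u a \<Longrightarrow> structural B u v b \<Longrightarrow> structural B t v (vcomp B b a)"
| str_hcomp: "structural B t t' a \<Longrightarrow> structural B u u' b \<Longrightarrow>
    Cod B (eval B t) = Dom B (eval B u) \<Longrightarrow>
    structural B (Comp u t) (Comp u' t') (hcomp B b a)"

definition comparison ::
    "('o, 'a, 'c) bicat \<Rightarrow> ('o, 'a) bracketing \<Rightarrow> ('o, 'a) bracketing \<Rightarrow> 'c" where
  "comparison B t u = (THE a. structural B t u a)"


section \<open>The double category of marked paths\<close>

type_synonym ('o, 'a) marked_path = "('o, 'a) path \<times> nat"
type_synonym ('o, 'a) dbl_hor = "('o, 'a) path \<times> nat \<times> nat"
type_synonym ('o, 'a) dbl_ver = "('o, 'a) marked_path \<times> ('o, 'a) marked_path"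
type_synonym ('o, 'a, 'c) dbl_sq = "('o, 'a) dbl_hor \<times> ('o, 'a) dbl_hor \<times> 'c"

definition marked_paths :: "('o, 'a, 'c) bicat \<Rightarrow> ('o, 'a) marked_path set" where
  "marked_paths B = {(P, i). is_path B P \<and> i \<le> path_length P}"

definition dbl_hors :: "('o, 'a, 'c) bicat \<Rightarrow> ('o, 'a) dbl_hor set" where
  "dbl_hors B = {(P, i, i'). is_path B P \<and> i \<le> i' \<and> i' \<le> path_length P}"

text \<open>
  A vertical arrow is unique when it exists, so it is the pair of its domain and codomain.
  A double cell is a triple of its top, its bottom and a 2-cell of \<open>B\<close>; its left and right
  sides are determined by the top and the bottom.
\<close>

definition dbl_vers :: "('o, 'a, 'c) bicat \<Rightarrow> ('o, 'a) dbl_ver set" where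
  "dbl_vers B = {((P, i), (Q, j)). (P, i) \<in> marked_paths B \<and> (Q, j) \<in> marked_paths B \<and>
     vertex B P i = vertex B Q j}"

fun chosen_composite :: "('o, 'a, 'c) bicat \<Rightarrow> (('o, 'a) path \<Rightarrow> ('o, 'a) bracketing) \<Rightarrow>
    ('o, 'a) dbl_hor \<Rightarrow> ('o, 'a) bracketing" where
  "chosen_composite B \<phi> (P, i, i') = \<phi> (segment B P i i')"

definition dbl_sqs :: "('o, 'a, 'c) bicat \<Rightarrow> (('o, 'a) path \<Rightarrow> ('o, 'a) bracketing) \<Rightarrow>
    ('o, 'a, 'c) dbl_sq set" where
  "dbl_sqs B \<phi> = {((P, i, i'), (Q, j, j'), a).
     (P, i, i') \<in> dbl_hors B \<and> (Q, j, j') \<in> dbl_hors B \<and>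
     vertex B P i = vertex B Q j \<and> vertex B P i' = vertex B Q j' \<and>
     a \<in> cells B (eval B (chosen_composite B \<phi> (P, i, i')))
                 (eval B (chosen_composite B \<phi> (Q, j, j')))}"

fun dbl_hdom :: "('o, 'a) dbl_hor \<Rightarrow> ('o, 'a) marked_path" where
  "dbl_hdom (P, i, i') = (P, i)"

fun dbl_hcod :: "('o, 'a) dbl_hor \<Rightarrow> ('o, 'a) marked_path" where
  "dbl_hcod (P, i, i') = (P, i')"

fun dbl_hor_id :: "('o, 'a) marked_path \<Rightarrow> ('o, 'a) dbl_hor" where
  "dbl_hor_id (P, i) = (P, i, i)"

fun dbl_hor_comp :: "('o, 'a) dbl_hor \<Rightarrow> ('o, 'a) dbl_hor \<Rightarrow> ('o, 'a) dbl_hor" where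
  "dbl_hor_comp (Q, j, j') (P, i, i') = (P, i, j')"

definition dbl_sq_ver_id :: "('o, 'a, 'c) bicat \<Rightarrow> (('o, 'a) path \<Rightarrow> ('o, 'a) bracketing) \<Rightarrow>
    ('o, 'a) dbl_hor \<Rightarrow> ('o, 'a, 'c) dbl_sq" where
  "dbl_sq_ver_id B \<phi> f = (f, f, ident B (eval B (chosen_composite B \<phi> f)))"

text \<open>
  The top and bottom of the horizontal identity cell on a vertical arrow have empty segments at
  the same object, hence the same chosen composite, namely the unit at that object.
\<close>

fun dbl_sq_hor_id :: "('o, 'a, 'c) bicat \<Rightarrow> ('o, 'a) dbl_ver \<Rightarrow> ('o, 'a, 'c) dbl_sq" where
  "dbl_sq_hor_id B ((P, i), (Q, j)) =
     ((P, i, i), (Q, j, j), ident B (unit1 B (vertex B P i)))"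

fun dbl_sq_ver_comp :: "('o, 'a, 'c) bicat \<Rightarrow>
    ('o, 'a, 'c) dbl_sq \<Rightarrow> ('o, 'a, 'c) dbl_sq \<Rightarrow> ('o, 'a, 'c) dbl_sq" where
  "dbl_sq_ver_comp B (g', h, b) (f, g, a) = (f, h, vcomp B b a)"

fun dbl_sq_hor_comp :: "('o, 'a, 'c) bicat \<Rightarrow> (('o, 'a) path \<Rightarrow> ('o, 'a) bracketing) \<Rightarrow>
    ('o, 'a, 'c) dbl_sq \<Rightarrow> ('o, 'a, 'c) dbl_sq \<Rightarrow> ('o, 'a, 'c) dbl_sq" where
  "dbl_sq_hor_comp B \<phi> (f', g', b) (f, g, a) =
     (let f'' = dbl_hor_comp f' f; g'' = dbl_hor_comp g' g; c = chosen_composite B \<phi>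
      in (f'', g'',
          vcomp B (comparison B (Comp (c g') (c g)) (c g''))
            (vcomp B (hcomp B b a)
              (comparison B (c f'') (Comp (c f') (c f))))))"

definition Dbl :: "('o, 'a, 'c) bicat \<Rightarrow> (('o, 'a) path \<Rightarrow> ('o, 'a) bracketing) \<Rightarrow>
    (('o, 'a) marked_path, ('o, 'a) dbl_hor, ('o, 'a) dbl_ver, ('o, 'a, 'c) dbl_sq) double_cat"
  where
  "Dbl B \<phi> = \<lparr>
     DObj = marked_paths B,
     Hor = dbl_hors B,
     Ver = dbl_vers B,
     Sq = dbl_sqs B \<phi>,
     hdom = dbl_hdom,
     hcod = dbl_hcod,
     vdom = fst,
     vcod = snd,
     top_of = (\<lambda>(f, g, a). f),
     bottom_of = (\<lambda>(f, g, a). g),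
     left_of = (\<lambda>(f, g, a). (dbl_hdom f, dbl_hdom g)),
     right_of = (\<lambda>(f, g, a). (dbl_hcod f, dbl_hcod g)),
     hor_id = dbl_hor_id,
     ver_id = (\<lambda>X. (X, X)),
     hor_comp = dbl_hor_comp,
     ver_comp = (\<lambda>w v. (fst v, snd w)),
     sq_ver_id = dbl_sq_ver_id B \<phi>,
     sq_hor_id = dbl_sq_hor_id B,
     sq_hor_comp = dbl_sq_hor_comp B \<phi>,
     sq_ver_comp = dbl_sq_ver_comp B\<rparr>"

end

theory Submission
  imports Defs
begin

text \<open>
  A companion pair amounts to 2-cells \<open>a : 1 \<Rightarrow> F\<close> and \<open>b : F \<Rightarrow> 1\<close>, with \<open>F\<close> the chosen
  composite. The vertical equation says \<open>b \<cdot> a = 1\<close>. The horizontal one says that \<open>b \<star> a\<close>,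
  conjugated by the unit cells, is the identity; by interchange, naturality of the unit cells
  and their agreement on unit arrows, that conjugate equals \<open>a \<cdot> b\<close>. So companion pairs are
  exactly pairs of mutually inverse 2-cells.

  That the comparison cells involved are the unit cells needs coherence. Each formal composite
  \<open>t\<close> acts on arrows \<open>e\<close> by composing with its arrows one after the other, and there is a
  canonical invertible cell from \<open>eval t \<odot> e\<close> to the result. Structural cells are compatible
  with these canonical cells, and are therefore determined by their source and target.
\<close>

text \<open>This is a normal form function: units act as the identity and composition of formal
  composites becomes composition of functions. Rebracketing and unit removal thus do not change the
  action at all, so formal composites linked by a structural cell have canonical cells with a common
  target.\<close>

fun act :: "('o, 'a, 'c) bicat \<Rightarrow> ('o, 'a) bracketing \<Rightarrow> 'a \<Rightarrow> 'a" where
  "act B (Unit A) e = e"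
| "act B (Arrow f) e = comp1 B f e"
| "act B (Comp u t) e = act B u (act B t e)"

fun act_cell :: "('o, 'a, 'c) bicat \<Rightarrow> ('o, 'a) bracketing \<Rightarrow> 'a \<Rightarrow> 'c" where
  "act_cell B (Unit A) e = lunit B e"
| "act_cell B (Arrow f) e = ident B (comp1 B f e)"
| "act_cell B (Comp u t) e =
     vcomp B (act_cell B u (act B t e))
       (vcomp B (hcomp B (ident B (eval B u)) (act_cell B t e))
         (assoc B (eval B u) (eval B t) e))"

context bicategory
begin

section \<open>Boundaries and calculus of 2-cells in a bicategory\<close>

lemma comp1_simps [simp]:
  assumes "f \<in> Arr B" "g \<in> Arr B" "Cod B f = Dom B g"
  shows "g \<odot> f \<in> Arr B" "Dom B (g \<odot> f) = Dom B f" "Cod B (g \<odot> f) = Cod B g"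
  using comp1[OF assms] by auto

lemma unit1_simps [simp]:
  assumes "A \<in> Obj B"
  shows "unit1 B A \<in> Arr B" "Dom B (unit1 B A) = A" "Cod B (unit1 B A) = A"
  using unit1[OF assms] by auto

lemma ident_simps [simp]:
  assumes "f \<in> Arr B"
  shows "ident B f \<in> Cell B" "Src B (ident B f) = f" "Tgt B (ident B f) = f"
  using ident[OF assms] by (auto simp: cells_def)

lemma vcomp_simps [simp]:
  assumes "a \<in> Cell B" "b \<in> Cell B" "Tgt B a = Src B b"
  shows "b \<cdot> a \<in> Cell B" "Src B (b \<cdot> a) = Src B a" "Tgt B (b \<cdot> a) = Tgt B b"
  using vcomp[of a "Src B a" "Tgt B a" b "Tgt B b"] assms by (auto simp: cells_def)

lemma hcomp_simps [simp]:
  assumes "a \<in> Cell B" "b \<in> Cell B" "Cod B (Src B a) = Dom B (Src B b)"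
  shows "b \<star> a \<in> Cell B" "Src B (b \<star> a) = Src B b \<odot> Src B a"
    "Tgt B (b \<star> a) = Tgt B b \<odot> Tgt B a"
  using hcomp[of a "Src B a" "Tgt B a" b "Src B b" "Tgt B b"] assms by (auto simp: cells_def)

lemma assoc_simps [simp]:
  assumes "f \<in> Arr B" "g \<in> Arr B" "h \<in> Arr B" "Cod B f = Dom B g" "Cod B g = Dom B h"
  shows "assoc B h g f \<in> Cell B" "Src B (assoc B h g f) = (h \<odot> g) \<odot> f"
    "Tgt B (assoc B h g f) = h \<odot> (g \<odot> f)" "invertible_cell B (assoc B h g f)"
  using assoc[OF assms] by (auto simp: cells_def)

lemma lunit_simps [simp]:
  assumes "f \<in> Arr B"
  shows "lunit B f \<in> Cell B" "Src B (lunit B f) = unit1 B (Cod B f) \<odot> f"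
    "Tgt B (lunit B f) = f" "invertible_cell B (lunit B f)"
  using lunit[OF assms] by (auto simp: cells_def)

lemma runit_simps [simp]:
  assumes "f \<in> Arr B"
  shows "runit B f \<in> Cell B" "Src B (runit B f) = f \<odot> unit1 B (Dom B f)"
    "Tgt B (runit B f) = f" "invertible_cell B (runit B f)"
  using runit[OF assms] by (auto simp: cells_def)

lemmas frame_simps [simp] = Dom_Obj Cod_Obj Src_Arr Tgt_Arr

lemma Dom_Tgt: "a \<in> Cell B \<Longrightarrow> Dom B (Tgt B a) = Dom B (Src B a)"
  and Cod_Tgt: "a \<in> Cell B \<Longrightarrow> Cod B (Tgt B a) = Cod B (Src B a)"
  by (simp_all add: Cell_Dom Cell_Cod)

lemma vcomp_assoc':
  assumes "a \<in> Cell B" "b \<in> Cell B" "c \<in> Cell B" "Tgt B a = Src B b" "Tgt B b = Src B c"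
  shows "(c \<cdot> b) \<cdot> a = c \<cdot> (b \<cdot> a)"
  using vcomp_assoc[of a "Src B a" "Tgt B a" b "Tgt B b" c "Tgt B c"] assms
  by (auto simp: cells_def)

lemma vcomp_ident [simp]:
  shows "a \<in> Cell B \<Longrightarrow> Src B a = f \<Longrightarrow> a \<cdot> ident B f = a"
    and "a \<in> Cell B \<Longrightarrow> Tgt B a = f \<Longrightarrow> ident B f \<cdot> a = a"
  using vcomp_ident_left vcomp_ident_right by (auto simp: cells_def)

lemma interchange':
  assumes "a \<in> Cell B" "a' \<in> Cell B" "b \<in> Cell B" "b' \<in> Cell B"
    "Tgt B a = Src B a'" "Tgt B b = Src B b'" "Cod B (Src B a) = Dom B (Src B b)"
  shows "(b' \<star> a') \<cdot> (b \<star> a) = (b' \<cdot> b) \<star> (a' \<cdot> a)"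
  using interchange[of a "Src B a" "Tgt B a" a' "Tgt B a'" b "Src B b" "Tgt B b" b' "Tgt B b'"]
    assms by (auto simp: cells_def)

lemma whisker_left_vcomp:
  assumes "a \<in> Cell B" "b \<in> Cell B" "Tgt B a = Src B b" "h \<in> Arr B"
    "Cod B (Src B a) = Dom B h"
  shows "ident B h \<star> (b \<cdot> a) = (ident B h \<star> b) \<cdot> (ident B h \<star> a)"
  using assms by (simp add: interchange')

lemma whisker_right_vcomp:
  assumes "a \<in> Cell B" "b \<in> Cell B" "Tgt B a = Src B b" "e \<in> Arr B"
    "Cod B e = Dom B (Src B a)"
  shows "(b \<cdot> a) \<star> ident B e = (b \<star> ident B e) \<cdot> (a \<star> ident B e)"
  using assms by (simp add: interchange')

text \<open>The boundaries are variables fixed by equations, so that the law applies to whatever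
  form the source and target arrows have been rewritten to.\<close>

lemma assoc_natural':
  assumes "a \<in> Cell B" "b \<in> Cell B" "c \<in> Cell B"
    "Src B a = f" "Src B b = g" "Src B c = h" "Tgt B a = f'" "Tgt B b = g'" "Tgt B c = h'"
    "Cod B f = Dom B g" "Cod B g = Dom B h"
  shows "assoc B h' g' f' \<cdot> ((c \<star> b) \<star> a) = (c \<star> (b \<star> a)) \<cdot> assoc B h g f"
  using assms by (intro assoc_natural) (auto simp: cells_def)

lemma lunit_natural':
  assumes "a \<in> Cell B" "Src B a = f" "Tgt B a = g" "A = Cod B f"
  shows "lunit B g \<cdot> (ident B (unit1 B A) \<star> a) = a \<cdot> lunit B f"
  using assms lunit_natural by (auto simp: cells_def)

lemma runit_natural':
  assumes "a \<in> Cell B" "Src B a = f" "Tgt B a = g" "A = Dom B f"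
  shows "runit B g \<cdot> (a \<star> ident B (unit1 B A)) = a \<cdot> runit B f"
  using assms runit_natural by (auto simp: cells_def)

section \<open>Invertible 2-cells, whiskering with units, and Kelly's unit identity\<close>

lemma inverse_cells_simps:
  assumes "inverse_cells B a b"
  shows "a \<in> Cell B" "b \<in> Cell B" "Src B b = Tgt B a" "Tgt B b = Src B a"
    "b \<cdot> a = ident B (Src B a)" "a \<cdot> b = ident B (Tgt B a)"
  using assms by (auto simp: inverse_cells_def cells_def)

lemma inverse_cellsI:
  assumes "a \<in> Cell B" "b \<in> Cell B" "Src B b = Tgt B a" "Tgt B b = Src B a"
    "b \<cdot> a = ident B (Src B a)" "a \<cdot> b = ident B (Tgt B a)"
  shows "inverse_cells B a b"
  using assms by (auto simp: inverse_cells_def cells_def)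

lemma invertible_cancel_left:
  assumes "invertible_cell B a" "b \<in> Cell B" "c \<in> Cell B"
    "Tgt B b = Src B a" "Tgt B c = Src B a" "a \<cdot> b = a \<cdot> c"
  shows "b = c"
proof -
  obtain a' where a': "inverse_cells B a a'"
    using assms(1) by (auto simp: invertible_cell_def)
  note [simp] = inverse_cells_simps[OF a']
  have "b = (a' \<cdot> a) \<cdot> b" using assms by simp
  also have "\<dots> = a' \<cdot> (a \<cdot> c)" using assms by (simp only: vcomp_assoc' inverse_cells_simps(1-4)[OF a'])
  also have "\<dots> = (a' \<cdot> a) \<cdot> c"
    using assms by (simp only: vcomp_assoc' inverse_cells_simps(1-4)[OF a'])
  also have "\<dots> = c" using assms by simp
  finally show ?thesis .
qed

lemma invertible_cancel_right:
  assumes "invertible_cell B a" "b \<in> Cell B" "c \<in> Cell B"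
    "Src B b = Tgt B a" "Src B c = Tgt B a" "b \<cdot> a = c \<cdot> a"
  shows "b = c"
proof -
  obtain a' where a': "inverse_cells B a a'"
    using assms(1) by (auto simp: invertible_cell_def)
  note [simp] = inverse_cells_simps[OF a']
  have "b = b \<cdot> (a \<cdot> a')" using assms by simp
  also have "\<dots> = (c \<cdot> a) \<cdot> a'"
    using assms by (simp only: vcomp_assoc'[symmetric] inverse_cells_simps(1-4)[OF a'])
  also have "\<dots> = c \<cdot> (a \<cdot> a')"
    using assms by (simp only: vcomp_assoc' inverse_cells_simps(1-4)[OF a'])
  also have "\<dots> = c" using assms by simp
  finally show ?thesis .
qed

lemma invertible_ident: "f \<in> Arr B \<Longrightarrow> invertible_cell B (ident B f)"
  unfolding invertible_cell_def
  by (rule exI[of _ "ident B f"], rule inverse_cellsI) simp_all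

lemma invertible_vcomp:
  assumes "invertible_cell B a" "invertible_cell B b" "Tgt B a = Src B b"
  shows "invertible_cell B (b \<cdot> a)"
proof -
  obtain a' where a': "inverse_cells B a a'"
    using assms(1) by (auto simp: invertible_cell_def)
  obtain b' where b': "inverse_cells B b b'"
    using assms(2) by (auto simp: invertible_cell_def)
  note [simp] = inverse_cells_simps[OF a'] inverse_cells_simps[OF b'] assms(3)
  have 1: "(a' \<cdot> b') \<cdot> (b \<cdot> a) = a' \<cdot> ((b' \<cdot> b) \<cdot> a)"
    by (simp add: vcomp_assoc' del: inverse_cells_simps(5,6)[OF b'])
  have 2: "(b \<cdot> a) \<cdot> (a' \<cdot> b') = b \<cdot> ((a \<cdot> a') \<cdot> b')"
    by (simp add: vcomp_assoc' del: inverse_cells_simps(5,6)[OF a'])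
  have "inverse_cells B (b \<cdot> a) (a' \<cdot> b')"
    by (rule inverse_cellsI) (simp_all add: 1 2)
  then show ?thesis by (auto simp: invertible_cell_def)
qed

lemma invertible_hcomp:
  assumes "invertible_cell B a" "invertible_cell B b" "Cod B (Src B a) = Dom B (Src B b)"
  shows "invertible_cell B (b \<star> a)"
proof -
  obtain a' where a': "inverse_cells B a a'"
    using assms(1) by (auto simp: invertible_cell_def)
  obtain b' where b': "inverse_cells B b b'"
    using assms(2) by (auto simp: invertible_cell_def)
  note [simp] = inverse_cells_simps[OF a'] inverse_cells_simps[OF b'] assms(3)
  have "inverse_cells B (b \<star> a) (b' \<star> a')"
    by (rule inverse_cellsI) (simp_all add: interchange' hcomp_ident Dom_Tgt Cod_Tgt)
  then show ?thesis by (auto simp: invertible_cell_def)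
qed

text \<open>Naturality of the left unit cell exhibits whiskering with a unit arrow as conjugation by
  invertible cells, so no information is lost.\<close>

lemma whisker_left_unit_faithful:
  assumes "a \<in> Cell B" "b \<in> Cell B" "Src B a = Src B b" "Tgt B a = Tgt B b"
    "A = Cod B (Src B b)" "ident B (unit1 B A) \<star> a = ident B (unit1 B A) \<star> b"
  shows "a = b"
proof (rule invertible_cancel_right)
  show "a \<cdot> lunit B (Src B a) = b \<cdot> lunit B (Src B a)"
    using lunit_natural'[of a _ _ A] lunit_natural'[of b _ _ A] assms by metis
qed (use assms in simp_all)

lemma whisker_right_unit_faithful:
  assumes "a \<in> Cell B" "b \<in> Cell B" "Src B a = Src B b" "Tgt B a = Tgt B b"
    "A = Dom B (Src B b)" "a \<star> ident B (unit1 B A) = b \<star> ident B (unit1 B A)"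
  shows "a = b"
proof (rule invertible_cancel_right)
  show "a \<cdot> runit B (Src B a) = b \<cdot> runit B (Src B a)"
    using runit_natural'[of a _ _ A] runit_natural'[of b _ _ A] assms by metis
qed (use assms in simp_all)

text \<open>Kelly's argument: it suffices to compare both sides after whiskering with the unit arrow
  \<open>I\<close> on the left and composing with the invertible cell \<open>?x\<close>, which is
  part of the pentagon for \<open>I\<close>, \<open>I\<close>, \<open>f\<close>, \<open>e\<close>.
  There the pentagon, two triangles and naturality of the associativity cell give the equality. The
  identity settles the left unit case of the coherence induction.\<close>

lemma lunit_comp1:
  assumes [simp]: "f \<in> Arr B" "e \<in> Arr B" "Cod B e = Dom B f"
  shows "lunit B (f \<odot> e) \<cdot> assoc B (unit1 B (Cod B f)) f e = lunit B f \<star> ident B e"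
proof -
  define I where "I = unit1 B (Cod B f)"
  have [simp]: "I \<in> Arr B" "Dom B I = Cod B f" "Cod B I = Cod B f"
    "unit1 B (Cod B f) = I" by (simp_all add: I_def)
  let ?x = "assoc B I (I \<odot> f) e \<cdot> (assoc B I I f \<star> ident B e)"
  have pent: "(ident B I \<star> assoc B I f e) \<cdot> ?x
      = assoc B I I (f \<odot> e) \<cdot> assoc B (I \<odot> I) f e"
    by (simp add: pentagon)
  have tri: "runit B I \<star> ident B f = (ident B I \<star> lunit B f) \<cdot> assoc B I I f"
    "(ident B I \<star> lunit B (f \<odot> e)) \<cdot> assoc B I I (f \<odot> e) = runit B I \<star> ident B (f \<odot> e)"
    using triangle[of f I] triangle[of "f \<odot> e" I] by simp_all
  have "(ident B I \<star> (lunit B (f \<odot> e) \<cdot> assoc B I f e)) \<cdot> ?x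
      = (ident B I \<star> lunit B (f \<odot> e)) \<cdot> ((ident B I \<star> assoc B I f e) \<cdot> ?x)"
    by (simp add: whisker_left_vcomp vcomp_assoc')
  also have "\<dots> = ((ident B I \<star> lunit B (f \<odot> e)) \<cdot> assoc B I I (f \<odot> e))
      \<cdot> assoc B (I \<odot> I) f e"
    unfolding pent by (simp add: vcomp_assoc')
  also have "\<dots> = assoc B I f e \<cdot> ((runit B I \<star> ident B f) \<star> ident B e)"
    unfolding tri(2) by (simp add: assoc_natural' hcomp_ident)
  also have "\<dots> = (assoc B I f e \<cdot> ((ident B I \<star> lunit B f) \<star> ident B e))
      \<cdot> (assoc B I I f \<star> ident B e)"
    unfolding tri(1) by (simp add: whisker_right_vcomp vcomp_assoc')
  also have "\<dots> = (ident B I \<star> (lunit B f \<star> ident B e)) \<cdot> ?x"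
    by (simp add: assoc_natural' vcomp_assoc')
  finally have "(ident B I \<star> (lunit B (f \<odot> e) \<cdot> assoc B I f e)) \<cdot> ?x
      = (ident B I \<star> (lunit B f \<star> ident B e)) \<cdot> ?x" .
  then have "ident B I \<star> (lunit B (f \<odot> e) \<cdot> assoc B I f e)
      = ident B I \<star> (lunit B f \<star> ident B e)"
    by (rule invertible_cancel_right[rotated -1])
      (simp_all add: invertible_vcomp invertible_hcomp invertible_ident)
  then have "lunit B (f \<odot> e) \<cdot> assoc B I f e = lunit B f \<star> ident B e"
    by - (rule whisker_left_unit_faithful[of _ _ "Cod B f"], simp_all)
  then show ?thesis by (simp only: I_def)
qed

section \<open>Coherence: structural cells are determined by their formal source and target\<close>

lemma eval_Arr [simp]: "well_formed B t \<Longrightarrow> eval B t \<in> Arr B"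
  by (induction t) simp_all

lemma act_simps [simp]:
  assumes "well_formed B t" "e \<in> Arr B" "Cod B e = Dom B (eval B t)"
  shows "act B t e \<in> Arr B" "Dom B (act B t e) = Dom B e"
    "Cod B (act B t e) = Cod B (eval B t)"
proof -
  have "act B t e \<in> Arr B \<and> Dom B (act B t e) = Dom B e \<and> Cod B (act B t e) = Cod B (eval B t)"
    using assms by (induction t arbitrary: e) simp_all
  then show "act B t e \<in> Arr B" "Dom B (act B t e) = Dom B e"
    "Cod B (act B t e) = Cod B (eval B t)" by simp_all
qed

lemma act_cell_simps [simp]:
  assumes "well_formed B t" "e \<in> Arr B" "Cod B e = Dom B (eval B t)"
  shows "act_cell B t e \<in> Cell B" "Src B (act_cell B t e) = eval B t \<odot> e"
    "Tgt B (act_cell B t e) = act B t e" "invertible_cell B (act_cell B t e)"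
proof -
  have "act_cell B t e \<in> Cell B \<and> Src B (act_cell B t e) = eval B t \<odot> e
      \<and> Tgt B (act_cell B t e) = act B t e \<and> invertible_cell B (act_cell B t e)"
    using assms
  proof (induction t arbitrary: e)
    case (Comp u t)
    then show ?case
      by (simp add: invertible_vcomp invertible_hcomp invertible_ident)
  qed (simp_all add: invertible_ident)
  then show "act_cell B t e \<in> Cell B" "Src B (act_cell B t e) = eval B t \<odot> e"
    "Tgt B (act_cell B t e) = act B t e" "invertible_cell B (act_cell B t e)" by simp_all
qed

lemma structural_frame:
  assumes "structural B t u a"
  shows "well_formed B t \<and> well_formed B u \<and> a \<in> cells B (eval B t) (eval B u)
    \<and> Dom B (eval B t) = Dom B (eval B u) \<and> Cod B (eval B t) = Cod B (eval B u)
    \<and> (\<forall>e. act B t e = act B u e)"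
  using assms
proof induction
  case (str_inverse t u a b)
  then show ?case by (auto simp: inverse_cells_def cells_def)
qed (auto simp: cells_def)

text \<open>Each way of building a structural cell is matched by one law: the pentagon for
  associativity, \<open>lunit_comp1\<close> for left units, the triangle for right units, and
  whiskering, interchange and naturality for inverses and composites. The equation type checks
  because \<open>t\<close> and \<open>u\<close> have the same action on \<open>e\<close>.\<close>

lemma structural_act_cell:
  assumes "structural B t u a" "e \<in> Arr B" "Cod B e = Dom B (eval B t)"
  shows "act_cell B u e \<cdot> (a \<star> ident B e) = act_cell B t e"
  using assms
proof (induction arbitrary: e)
  case (str_ident t)
  then show ?case by (simp add: hcomp_ident)
next
  case (str_assoc v u t)
  then have [simp]: "well_formed B v" "well_formed B u" "well_formed B t" "e \<in> Arr B"
    "Cod B (eval B t) = Dom B (eval B u)" "Cod B (eval B u) = Dom B (eval B v)"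
    "Cod B e = Dom B (eval B t)" by simp_all
  let ?v = "eval B v" and ?u = "eval B u" and ?t = "eval B t" and ?e' = "act B t e"
  let ?V = "act_cell B v (act B u ?e')" and ?U = "ident B ?v \<star> act_cell B u ?e'"
  let ?T = "ident B ?v \<star> (ident B ?u \<star> act_cell B t e)"
  have "act_cell B (Comp v (Comp u t)) e \<cdot> (assoc B ?v ?u ?t \<star> ident B e)
      = ?V \<cdot> (?U \<cdot> (?T \<cdot> ((ident B ?v \<star> assoc B ?u ?t e)
        \<cdot> (assoc B ?v (?u \<odot> ?t) e \<cdot> (assoc B ?v ?u ?t \<star> ident B e)))))"
    by (simp add: whisker_left_vcomp vcomp_assoc')
  \<comment> \<open>The pentagon replaces the three associativity cells by two; naturality then
    moves \<open>?T\<close> past the first of them.\<close>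
  also have "\<dots> = ?V \<cdot> (?U \<cdot> ((?T \<cdot> assoc B ?v ?u (?t \<odot> e)) \<cdot> assoc B (?v \<odot> ?u) ?t e))"
    by (simp add: pentagon[symmetric] vcomp_assoc')
  also have "?T \<cdot> assoc B ?v ?u (?t \<odot> e)
      = assoc B ?v ?u ?e' \<cdot> (ident B (?v \<odot> ?u) \<star> act_cell B t e)"
    by (simp add: assoc_natural'[symmetric] hcomp_ident)
  also have "?V \<cdot> (?U \<cdot> (\<dots> \<cdot> assoc B (?v \<odot> ?u) ?t e)) = act_cell B (Comp (Comp v u) t) e"
    by (simp add: vcomp_assoc')
  finally show ?case by simp
next
  case (str_lunit t)
  then have [simp]: "well_formed B t" "e \<in> Arr B" "Cod B e = Dom B (eval B t)"
    by simp_all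
  let ?t = "eval B t" and ?I = "unit1 B (Cod B (eval B t))"
  have "act_cell B t e \<cdot> (lunit B ?t \<star> ident B e)
      = (act_cell B t e \<cdot> lunit B (?t \<odot> e)) \<cdot> assoc B ?I ?t e"
    by (simp add: lunit_comp1[symmetric] vcomp_assoc')
  also have "act_cell B t e \<cdot> lunit B (?t \<odot> e)
      = lunit B (act B t e) \<cdot> (ident B ?I \<star> act_cell B t e)"
    by (simp add: lunit_natural')
  finally show ?case by (simp add: vcomp_assoc')
next
  case (str_runit t)
  \<comment> \<open>The unit fixes \<open>e\<close> and its canonical cell there is
    \<open>lunit B e\<close>, so this is the triangle followed by
    \<open>act_cell B t e\<close>.\<close>
  then show ?case using triangle[of e "eval B t"] by simp
next
  case (str_inverse t u a b)
  note fr = structural_frame[OF str_inverse.hyps(1)]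
  note [simp] = inverse_cells_simps[OF str_inverse.hyps(2)]
  from fr str_inverse.prems
  have [simp]: "well_formed B t" "well_formed B u" "e \<in> Arr B" "Src B a = eval B t"
    "Tgt B a = eval B u" "Cod B e = Dom B (eval B t)" "Dom B (eval B u) = Dom B (eval B t)"
    by (auto simp: cells_def)
  have "act_cell B t e \<cdot> (b \<star> ident B e)
      = (act_cell B u e \<cdot> (a \<star> ident B e)) \<cdot> (b \<star> ident B e)"
    by (simp add: str_inverse.IH)
  also have "\<dots> = act_cell B u e \<cdot> ((a \<star> ident B e) \<cdot> (b \<star> ident B e))"
    by (simp add: vcomp_assoc')
  also have "\<dots> = act_cell B u e"
    by (simp add: interchange' hcomp_ident)
  finally show ?case .
next
  case (str_vcomp t u a v b)
  from structural_frame[OF str_vcomp.hyps(1)] structural_frame[OF str_vcomp.hyps(2)]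
    str_vcomp.prems
  have [simp]: "well_formed B t" "well_formed B u" "well_formed B v" "e \<in> Arr B"
    "a \<in> Cell B" "b \<in> Cell B" "Src B a = eval B t" "Tgt B a = eval B u"
    "Src B b = eval B u" "Tgt B b = eval B v" "Cod B e = Dom B (eval B t)"
    "Dom B (eval B u) = Dom B (eval B t)" "Dom B (eval B v) = Dom B (eval B t)"
    by (auto simp: cells_def)
  have "act_cell B v e \<cdot> ((b \<cdot> a) \<star> ident B e)
      = (act_cell B v e \<cdot> (b \<star> ident B e)) \<cdot> (a \<star> ident B e)"
    by (simp add: whisker_right_vcomp vcomp_assoc')
  then show ?case by (simp add: str_vcomp.IH)
next
  case (str_hcomp t t' a u u' b)
  from structural_frame[OF str_hcomp.hyps(1)] structural_frame[OF str_hcomp.hyps(2)]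
    str_hcomp.prems str_hcomp.hyps(3)
  have [simp]: "well_formed B t" "well_formed B u" "well_formed B t'" "well_formed B u'"
    "e \<in> Arr B" "a \<in> Cell B" "b \<in> Cell B" "Src B a = eval B t" "Tgt B a = eval B t'"
    "Src B b = eval B u" "Tgt B b = eval B u'" "Cod B e = Dom B (eval B t)"
    "Dom B (eval B t') = Dom B (eval B t)" "Dom B (eval B u') = Dom B (eval B u)"
    "Cod B (eval B t') = Dom B (eval B u)" "Cod B (eval B u') = Cod B (eval B u)"
    "Cod B (eval B t) = Dom B (eval B u)" "act B t' = act B t" "act B u' = act B u"
    by (auto simp: cells_def)
  let ?u = "eval B u" and ?u' = "eval B u'" and ?t = "eval B t" and ?t' = "eval B t'"
  let ?e' = "act B t e"
  have "act_cell B (Comp u' t') e \<cdot> ((b \<star> a) \<star> ident B e)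
      = act_cell B u' ?e' \<cdot> ((ident B ?u' \<star> act_cell B t' e)
        \<cdot> (assoc B ?u' ?t' e \<cdot> ((b \<star> a) \<star> ident B e)))"
    by (simp add: vcomp_assoc')
  also have "\<dots> = act_cell B u' ?e' \<cdot> (((ident B ?u' \<star> act_cell B t' e)
        \<cdot> (b \<star> (a \<star> ident B e))) \<cdot> assoc B ?u ?t e)"
    by (simp add: assoc_natural' vcomp_assoc')
  \<comment> \<open>By interchange and the induction hypothesis for \<open>a\<close>, both sides
    equal \<open>b \<star> act_cell B t e\<close>.\<close>
  also have "(ident B ?u' \<star> act_cell B t' e) \<cdot> (b \<star> (a \<star> ident B e))
      = (b \<star> ident B ?e') \<cdot> (ident B ?u \<star> act_cell B t e)"
    by (simp add: interchange' str_hcomp.IH)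
  also have "act_cell B u' ?e' \<cdot> (\<dots> \<cdot> assoc B ?u ?t e)
      = (act_cell B u' ?e' \<cdot> (b \<star> ident B ?e'))
        \<cdot> ((ident B ?u \<star> act_cell B t e) \<cdot> assoc B ?u ?t e)"
    by (simp add: vcomp_assoc')
  also have "\<dots> = act_cell B (Comp u t) e"
    by (simp add: str_hcomp.IH)
  finally show ?case .
qed

text \<open>Let both formal composites act on the unit arrow at their common domain. The invertible
  canonical cell of \<open>u\<close> cancels, leaving equal whiskerings with a unit, and such
  whiskering is faithful.\<close>

theorem structural_unique:
  assumes "structural B t u a" "structural B t u b"
  shows "a = b"
proof -
  from structural_frame[OF assms(1)] structural_frame[OF assms(2)]
  have [simp]: "well_formed B t" "well_formed B u" "a \<in> Cell B" "b \<in> Cell B"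
    "Src B a = eval B t" "Tgt B a = eval B u" "Src B b = eval B t" "Tgt B b = eval B u"
    "Dom B (eval B u) = Dom B (eval B t)" by (auto simp: cells_def)
  let ?I = "unit1 B (Dom B (eval B t))"
  have "act_cell B u ?I \<cdot> (a \<star> ident B ?I) = act_cell B u ?I \<cdot> (b \<star> ident B ?I)"
    using assms by (simp add: structural_act_cell)
  then have "a \<star> ident B ?I = b \<star> ident B ?I"
    by (rule invertible_cancel_left[rotated -1]) simp_all
  then show ?thesis
    by - (rule whisker_right_unit_faithful[of _ _ "Dom B (eval B t)"], simp_all)
qed

text \<open>Uniqueness makes the definite description in \<open>comparison\<close> denote any
  structural cell that can be exhibited.\<close>

lemma comparison_eq: "structural B t u a \<Longrightarrow> comparison B t u = a"
  unfolding comparison_def by (blast intro: the_equality structural_unique)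

section \<open>The horizontal companion equation rewritten as a vertical composite\<close>

lemma lunit_unit1: "A \<in> Obj B \<Longrightarrow> lunit B (unit1 B A) = runit B (unit1 B A)"
  using structural_unique[of "Comp (Unit A) (Unit A)" "Unit A"]
    str_lunit[of B "Unit A"] str_runit[of B "Unit A"] by simp

lemma unit_conjugate:
  assumes A [simp]: "A \<in> Obj B" and t: "well_formed B t"
    and ends: "Dom B (eval B t) = A" "Cod B (eval B t) = A"
    and a: "a \<in> cells B (unit1 B A) (eval B t)" and b: "b \<in> cells B (eval B t) (unit1 B A)"
  shows "comparison B (Comp (Unit A) t) t \<cdot> ((b \<star> a) \<cdot> comparison B t (Comp t (Unit A))) = a \<cdot> b"
proof -
  let ?F = "eval B t" and ?I = "unit1 B A"
  obtain r where r: "inverse_cells B (runit B ?F) r"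
    using runit[of ?F] t by (auto simp: invertible_cell_def)
  note [simp] = inverse_cells_simps(2-4,6)[OF r] t ends
  have [simp]: "a \<in> Cell B" "Src B a = ?I" "Tgt B a = ?F"
    "b \<in> Cell B" "Src B b = ?F" "Tgt B b = ?I"
    using a b by (auto simp: cells_def)
  have l: "comparison B (Comp (Unit A) t) t = lunit B ?F"
    using str_lunit[OF t] by (simp add: comparison_eq)
  \<comment> \<open>The comparison that starts at \<open>t\<close> runs against the right unit cell,
    hence is its inverse \<open>r\<close>.\<close>
  have "structural B (Comp t (Unit A)) t (runit B ?F)"
    using str_runit[OF t] by simp
  from comparison_eq[OF str_inverse[OF this r]]
  have r': "comparison B t (Comp t (Unit A)) = r" .
  \<comment> \<open>Applying \<open>b\<close> before \<open>a\<close> factors the cell through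
    \<open>?I \<odot> ?I\<close>, the one place where left and right unit cells can be
    exchanged.\<close>
  have "b \<star> a = (ident B ?I \<star> a) \<cdot> (b \<star> ident B ?I)"
    by (simp add: interchange')
  then have "lunit B ?F \<cdot> ((b \<star> a) \<cdot> r)
      = (lunit B ?F \<cdot> (ident B ?I \<star> a)) \<cdot> ((b \<star> ident B ?I) \<cdot> r)"
    by (simp add: vcomp_assoc')
  also have "lunit B ?F \<cdot> (ident B ?I \<star> a) = a \<cdot> runit B ?I"
    by (simp add: lunit_natural' lunit_unit1)
  also have "(a \<cdot> runit B ?I) \<cdot> ((b \<star> ident B ?I) \<cdot> r)
      = a \<cdot> ((runit B ?I \<cdot> (b \<star> ident B ?I)) \<cdot> r)"
    by (simp add: vcomp_assoc')
  also have "runit B ?I \<cdot> (b \<star> ident B ?I) = b \<cdot> runit B ?F"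
    by (simp add: runit_natural')
  also have "a \<cdot> (b \<cdot> runit B ?F \<cdot> r) = a \<cdot> b"
    by (simp add: vcomp_assoc')
  finally show ?thesis by (simp add: l r')
qed

section \<open>Segments of paths and boundaries of their chosen composites\<close>

lemma vertex_Suc: "vertex B (A, f # fs) (Suc i) = vertex B (Cod B f, fs) i"
  by (cases i) (simp_all add: vertex_def)

lemma is_path_segment:
  assumes "is_path B P" "i \<le> j" "j \<le> path_length P"
  shows "is_path B (segment B P i j)"
proof -
  obtain A fs where P: "P = (A, fs)" by (cases P)
  have "is_path B (vertex B (A, fs) i, drop i (take j fs))"
    using assms unfolding P
  proof (induction fs arbitrary: A i j)
    case Nil
    then show ?case by (simp add: vertex_def)
  next
    case (Cons f fs)
    show ?case
    proof (cases i)
      case 0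
      show ?thesis
      proof (cases j)
        case 0
        then show ?thesis using Cons.prems \<open>i = 0\<close> by (auto simp: vertex_def)
      next
        case (Suc j')
        then show ?thesis using Cons.prems Cons.IH[of "Cod B f" 0 j'] \<open>i = 0\<close>
          by (simp add: vertex_def)
      qed
    next
      case (Suc i')
      then obtain j' where "j = Suc j'" using Cons.prems by (cases j) auto
      then show ?thesis using Suc Cons by (simp add: vertex_Suc)
    qed
  qed
  then show ?thesis by (simp add: P segment_def)
qed

lemma vertex_segment:
  assumes "i \<le> j" "j \<le> path_length P"
  shows "vertex B (segment B P i j) (path_length (segment B P i j)) = vertex B P j"
  using assms by (auto simp: vertex_def segment_def)

lemma is_path_append:
  "is_path B (A, fs @ gs) \<longleftrightarrow>
    is_path B (A, fs) \<and> is_path B (vertex B (A, fs) (length fs), gs)"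
proof (induction fs arbitrary: A)
  case Nil
  then show ?case by (cases gs) (auto simp: vertex_def)
next
  case (Cons f fs)
  then show ?case by (auto simp: vertex_Suc)
qed

lemma vertex_append:
  "vertex B (A, fs @ gs) (length fs + i) = vertex B (vertex B (A, fs) (length fs), gs) i"
proof (induction fs arbitrary: A)
  case Nil
  then show ?case by (simp add: vertex_def)
next
  case (Cons f fs)
  then show ?case by (simp add: vertex_Suc)
qed

text \<open>The list \<open>arrows t\<close> does not record units, so a stray \<open>Unit\<close>
  at an unrelated object could spoil composability. In a unit-free term the endpoints of every
  subterm are read off the path, which is split at each \<open>Comp\<close>.\<close>

lemma unit_free_well_formed:
  assumes "unit_free t" "is_path B (A, arrows t)"
  shows "well_formed B t \<and> Dom B (eval B t) = A
    \<and> Cod B (eval B t) = vertex B (A, arrows t) (length (arrows t))"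
  using assms
proof (induction t arbitrary: A)
  case (Comp u t)
  from Comp.prems
  have t: "is_path B (A, arrows t)"
    and u: "is_path B (vertex B (A, arrows t) (length (arrows t)), arrows u)"
    by (simp_all add: is_path_append)
  show ?case using Comp.IH(1)[OF _ u] Comp.IH(2)[OF _ t] Comp.prems(1)
    by (simp add: vertex_append)
qed (auto simp: vertex_def)

lemma choice_of_composites_well_formed:
  assumes "choice_of_composites B \<phi>" "is_path B P"
  shows "well_formed B (\<phi> P)" "Dom B (eval B (\<phi> P)) = fst P"
    "Cod B (eval B (\<phi> P)) = vertex B P (path_length P)"
proof -
  obtain A fs where P: "P = (A, fs)" by (cases P)
  have "well_formed B (\<phi> P) \<and> Dom B (eval B (\<phi> P)) = fst P
    \<and> Cod B (eval B (\<phi> P)) = vertex B P (path_length P)"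
  proof (cases "fs = []")
    case True
    then show ?thesis using assms P by (simp add: choice_of_composites_def vertex_def)
  next
    case False
    then have "unit_free (\<phi> P)" "arrows (\<phi> P) = fs"
      using assms P by (auto simp: choice_of_composites_def)
    then show ?thesis using unit_free_well_formed[of "\<phi> P" A] assms(2) P by simp
  qed
  then show "well_formed B (\<phi> P)" "Dom B (eval B (\<phi> P)) = fst P"
    "Cod B (eval B (\<phi> P)) = vertex B P (path_length P)" by simp_all
qed

text \<open>Here \<open>b\<close> is the invertible cell to the unit and \<open>a\<close> its
  inverse, oriented like the cells of a companion pair.\<close>

lemma quasi_unit_iff:
  assumes "f \<in> Arr B" "Dom B f = A" "Cod B f = A"
  shows "quasi_unit B f \<longleftrightarrow> (\<exists>a \<in> cells B (unit1 B A) f. \<exists>b \<in> cells B f (unit1 B A).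
    b \<cdot> a = ident B (unit1 B A) \<and> a \<cdot> b = ident B f)"
  using assms by (auto simp: quasi_unit_def invertible_cell_def inverse_cells_def cells_def)

end

section \<open>Companions in the double category of marked paths\<close>

lemma is_square_Dbl:
  "is_square (Dbl B \<phi>) s f l r g \<longleftrightarrow>
    l = (dbl_hdom f, dbl_hdom g) \<and> r = (dbl_hcod f, dbl_hcod g) \<and>
    (\<exists>a. s = (f, g, a) \<and> (f, g, a) \<in> dbl_sqs B \<phi>)"
proof -
  obtain f' g' a where s: "s = (f', g', a)" by (cases s)
  show ?thesis
    unfolding s is_square_def Dbl_def double_cat.simps prod.case prod.inject by blast
qed

theorem proposition6p6:
  fixes B :: "('o, 'a, 'c) bicat"
    and \<phi> :: "('o, 'a) path \<Rightarrow> ('o, 'a) bracketing"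
    and P :: "('o, 'a) path"
    and i0 i1 :: nat
  assumes "bicategory B"
    and "choice_of_composites B \<phi>"
    and "(P, i0, i1) \<in> Hor (Dbl B \<phi>)"
  shows "has_companion (Dbl B \<phi>) (P, i0, i1) \<longleftrightarrow>
    vertex B P i0 = vertex B P i1 \<and> quasi_unit B (eval B (\<phi> (segment B P i0 i1)))"
proof -
  interpret bicategory B by fact
  from assms(3) have P: "is_path B P" "i0 \<le> i1" "i1 \<le> path_length P"
    by (auto simp: Dbl_def dbl_hors_def)
  let ?t = "\<phi> (segment B P i0 i1)" and ?A = "vertex B P i0"
  have t: "well_formed B ?t" "Dom B (eval B ?t) = ?A" "Cod B (eval B ?t) = vertex B P i1"
    using choice_of_composites_well_formed[OF assms(2) is_path_segment[OF P]]
      vertex_segment[OF P(2,3)]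
    by (simp_all add: segment_def)
  have A: "?A \<in> Obj B" using t(2) Dom_Obj[OF eval_Arr[OF t(1)]] by simp
  have unit: "\<phi> (segment B P i i) = Unit (vertex B P i)" if "vertex B P i \<in> Obj B" for i
    using assms(2) that by (simp add: choice_of_composites_def segment_def)
  show ?thesis
  proof (cases "vertex B P i0 = vertex B P i1")
    \<comment> \<open>No vertical arrow joins the two marks, so both sides of the equivalence
      fail.\<close>
    case False
    then show ?thesis
      by (auto simp: has_companion_def companions_def Dbl_def dbl_vers_def)
  next
    case True
    \<comment> \<open>Both marks carry the same object, so the identity horizontal arrows at the two
      ends have the same chosen composite.\<close>
    have units: "\<phi> (segment B P i0 i0) = Unit ?A" "\<phi> (segment B P i1 i1) = Unit ?A"
      using unit[of i0] unit[of i1] A True by simp_all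
    have "has_companion (Dbl B \<phi>) (P, i0, i1) \<longleftrightarrow>
      (\<exists>a \<in> cells B (unit1 B ?A) (eval B ?t). \<exists>b \<in> cells B (eval B ?t) (unit1 B ?A).
        b \<cdot>\<^bsub>B\<^esub> a = ident B (unit1 B ?A) \<and>
        comparison B (Comp (Unit ?A) ?t) ?t \<cdot>\<^bsub>B\<^esub>
          ((b \<star>\<^bsub>B\<^esub> a) \<cdot>\<^bsub>B\<^esub> comparison B ?t (Comp ?t (Unit ?A))) = ident B (eval B ?t))"
    proof -
      let ?D = "Dbl B \<phi>"
      \<comment> \<open>Vertical arrows are determined by their ends, so there is a single candidate
        for the companion.\<close>
      have ver: "v \<in> Ver ?D \<and> vdom ?D v = (P, i0) \<and> vcod ?D v = (P, i1)
          \<longleftrightarrow> v = ((P, i0), (P, i1))" for v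
        using P True by (cases v) (auto simp: Dbl_def dbl_vers_def marked_paths_def)
      have \<psi>: "((P, i0, i0), (P, i0, i1), a) \<in> dbl_sqs B \<phi>
          \<longleftrightarrow> a \<in> cells B (unit1 B ?A) (eval B ?t)" for a
        using P True units by (simp add: dbl_sqs_def dbl_hors_def)
      have \<chi>: "((P, i0, i1), (P, i1, i1), b) \<in> dbl_sqs B \<phi>
          \<longleftrightarrow> b \<in> cells B (eval B ?t) (unit1 B ?A)" for b
        using P True units by (simp add: dbl_sqs_def dbl_hors_def)
      have D: "hdom ?D (P, i0, i1) = (P, i0)" "hcod ?D (P, i0, i1) = (P, i1)"
        "hor_id ?D (P, i) = (P, i, i)" "ver_id ?D X = (X, X)" for i X
        by (simp_all add: Dbl_def)
      \<comment> \<open>The tops of the two cells are \<open>?t\<close> after an empty segment, the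
        bottoms an empty segment after \<open>?t\<close>. So the first comparison to be applied
        inserts a unit on the right and the last one removes a unit on the left.\<close>
      have H: "sq_hor_comp ?D ((P, i0, i1), (P, i1, i1), b) ((P, i0, i0), (P, i0, i1), a)
            = sq_ver_id ?D (P, i0, i1) \<longleftrightarrow>
          comparison B (Comp (Unit ?A) ?t) ?t \<cdot>\<^bsub>B\<^esub>
            ((b \<star>\<^bsub>B\<^esub> a) \<cdot>\<^bsub>B\<^esub> comparison B ?t (Comp ?t (Unit ?A))) = ident B (eval B ?t)" for a b
        using units by (simp add: Dbl_def dbl_sq_ver_id_def Let_def)
      have V: "sq_ver_comp ?D ((P, i0, i1), (P, i1, i1), b) ((P, i0, i0), (P, i0, i1), a)
            = sq_hor_id ?D ((P, i0), (P, i1)) \<longleftrightarrow> b \<cdot>\<^bsub>B\<^esub> a = ident B (unit1 B ?A)" for a b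
        by (simp add: Dbl_def)
      have "has_companion ?D (P, i0, i1) \<longleftrightarrow> companions ?D (P, i0, i1) ((P, i0), (P, i1))"
      proof -
        have "v = ((P, i0), (P, i1))" if "companions ?D (P, i0, i1) v" for v
          using that ver[of v] by (simp add: companions_def D)
        then show ?thesis unfolding has_companion_def by blast
      qed
      also have "\<dots> \<longleftrightarrow> (\<exists>a b. a \<in> cells B (unit1 B ?A) (eval B ?t) \<and>
          b \<in> cells B (eval B ?t) (unit1 B ?A) \<and>
          comparison B (Comp (Unit ?A) ?t) ?t \<cdot>\<^bsub>B\<^esub>
            ((b \<star>\<^bsub>B\<^esub> a) \<cdot>\<^bsub>B\<^esub> comparison B ?t (Comp ?t (Unit ?A))) = ident B (eval B ?t) \<and>
          b \<cdot>\<^bsub>B\<^esub> a = ident B (unit1 B ?A))"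
        using assms(3) ver[of "((P, i0), (P, i1))"]
        by (simp add: companions_def D is_square_Dbl \<psi> \<chi>) (use H V in metis)
      finally show ?thesis by blast
    qed
    also have "\<dots> \<longleftrightarrow> quasi_unit B (eval B ?t)"
      \<comment> \<open>With the conjugate replaced by the vertical composite of \<open>a\<close>
        after \<open>b\<close>, the two companion equations say that \<open>a\<close> and
        \<open>b\<close> are mutually inverse.\<close>
      unfolding quasi_unit_iff[OF eval_Arr[OF t(1)] t(2) t(3)[folded True]]
      using unit_conjugate[OF A t(1,2) t(3)[folded True]] by (simp cong: bex_cong)
    finally show ?thesis using True by simp
  qed
qed

end
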